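(* For every integer $n>2$ and every integer $m>1$, there is no topological space $X$ that is $n$-Hausdorff, not Hausdorff, and $m$-homogeneous.
   Context: No separation axioms are assumed unless stated. The Hausdorff number $H(X)$ of a topological space $X$ is the least cardinal $\kappa$ (finite or infinite) such that for every $A\subseteq X$ with $|A|\ge\kappa$ there are open neighbourhoods $U_a$ of $a$, for $a\in A$, with $\bigcap_{a\in A}U_a=\emptyset$. For an integer $n\ge 2$, $X$ is $n$-Hausdorff if $H(X)\le n$. For an integer $m\ge 1$, $X$ is $m$-homogeneous if for all $x_1,\dots,x_m,y_1,\dots,y_m\in X$ such that $x_i=x_j$ if and only if $y_i=y_j$ (for all $i,j$), there is a homeomorphism $h:X\to X$ with $h(x_i)=y_i$ for all $i=1,\dots,m$.
   Formalization: The formal statement assumes that X has at least n points; without this the claim fails, since an indiscrete space with at least 2 but fewer than n points is vacuously n-Hausdorff, m-homogeneous and not Hausdorff. *)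

theory Defs
  imports "HOL-Analysis.Analysis"
begin

unbundle cardinal_syntax

text \<open>Cardinals are cardinal orders \<open>\<kappa>\<close> (\<open>Card_order \<kappa>\<close>), compared by \<open>\<le>o\<close>; \<open>|A|\<close> is the cardinality
  of the set \<open>A\<close>. Intersecting with \<open>topspace X\<close> only matters for \<open>A = {}\<close>, where the
  empty intersection is taken to be the whole space.\<close>

definition separates_from :: "'b rel \<Rightarrow> 'a topology \<Rightarrow> bool" where
  "separates_from \<kappa> X \<longleftrightarrow>
    (\<forall>A. A \<subseteq> topspace X \<and> \<kappa> \<le>o |A| \<longrightarrow>
      (\<exists>U. (\<forall>a\<in>A. openin X (U a) \<and> a \<in> U a) \<and> topspace X \<inter> (\<Inter>a\<in>A. U a) = {}))"

text \<open>The least such cardinal, represented as a cardinal order on \<open>'a set\<close> (hence only unique up to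
  \<open>=o\<close>). This type is large enough, because the successor of \<open>|topspace X|\<close> lives on it
  and satisfies the condition vacuously. It is then also least among the cardinals on all other
  types, see \<open>Hausdorff_number_least\<close> below.\<close>

definition Hausdorff_number :: "'a topology \<Rightarrow> 'a set rel" where
  "Hausdorff_number X = (SOME \<kappa>. Card_order \<kappa> \<and> separates_from \<kappa> X \<and>
    (\<forall>\<kappa>'::'a set rel. Card_order \<kappa>' \<and> separates_from \<kappa>' X \<longrightarrow> \<kappa> \<le>o \<kappa>'))"

definition n_Hausdorff :: "nat \<Rightarrow> 'a topology \<Rightarrow> bool" where
  "n_Hausdorff n X \<longleftrightarrow> Hausdorff_number X \<le>o |{..<n}|"

definition m_homogeneous :: "nat \<Rightarrow> 'a topology \<Rightarrow> bool" where
  "m_homogeneous m X \<longleftrightarrow>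
    (\<forall>x y. (\<forall>i\<in>{1..m}. x i \<in> topspace X \<and> y i \<in> topspace X) \<and>
           (\<forall>i\<in>{1..m}. \<forall>j\<in>{1..m}. x i = x j \<longleftrightarrow> y i = y j) \<longrightarrow>
      (\<exists>h. homeomorphic_map X X h \<and> (\<forall>i\<in>{1..m}. h (x i) = y i)))"

lemma separates_from_mono:
  assumes "separates_from \<kappa> X" "\<kappa> \<le>o \<kappa>'"
  shows "separates_from \<kappa>' X"
  using assms unfolding separates_from_def by (meson ordLeq_transitive)

lemma Hausdorff_number_props:
  fixes X :: "'a topology"
  shows Card_order_Hausdorff_number: "Card_order (Hausdorff_number X)"
    and separates_from_Hausdorff_number: "separates_from (Hausdorff_number X) X"
    and Hausdorff_number_least_aux:
      "\<And>\<kappa>'::'a set rel. Card_order \<kappa>' \<Longrightarrow> separates_from \<kappa>' X \<Longrightarrow> Hausdorff_number X \<le>o \<kappa>'"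
proof -
  let ?R = "{\<kappa>::'a set rel. Card_order \<kappa> \<and> separates_from \<kappa> X}"
  let ?s = "cardSuc |topspace X|"
  have "\<not> ?s \<le>o |A|" if "A \<subseteq> topspace X" for A
  proof
    assume "?s \<le>o |A|"
    then have "?s \<le>o |topspace X|"
      using card_of_mono1[OF that] ordLeq_transitive by blast
    then show False
      using cardSuc_greater[of "|topspace X|"] card_of_Card_order not_ordLess_ordLeq by blast
  qed
  then have "separates_from ?s X"
    unfolding separates_from_def by blast
  then have "?s \<in> ?R"
    by (simp add: cardSuc_Card_order[OF card_of_Card_order])
  then have "\<exists>\<kappa>\<in>?R. \<forall>\<kappa>'\<in>?R. \<kappa> \<le>o \<kappa>'"
    by (intro exists_minim_Card_order) auto
  then have "\<exists>\<kappa>::'a set rel. Card_order \<kappa> \<and> separates_from \<kappa> X \<and>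
      (\<forall>\<kappa>'::'a set rel. Card_order \<kappa>' \<and> separates_from \<kappa>' X \<longrightarrow> \<kappa> \<le>o \<kappa>')"
    by blast
  from someI_ex[OF this, folded Hausdorff_number_def]
  show "Card_order (Hausdorff_number X)" "separates_from (Hausdorff_number X) X"
    "\<And>\<kappa>'::'a set rel. Card_order \<kappa>' \<Longrightarrow> separates_from \<kappa>' X \<Longrightarrow> Hausdorff_number X \<le>o \<kappa>'"
    by blast+
qed

lemma Hausdorff_number_least:
  fixes X :: "'a topology" and \<kappa> :: "'b rel"
  assumes "Card_order \<kappa>" "separates_from \<kappa> X"
  shows "Hausdorff_number X \<le>o \<kappa>"
proof (rule ccontr)
  assume "\<not> Hausdorff_number X \<le>o \<kappa>"
  then have "\<kappa> \<le>o Hausdorff_number X"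
    using assms(1) Card_order_Hausdorff_number
    by (meson card_order_on_well_order_on ordLeq_total)
  then have "|Field \<kappa>| \<le>o |Field (Hausdorff_number X)|"
    by (rule card_of_mono2)
  then obtain f where f: "inj_on f (Field \<kappa>)" "f ` Field \<kappa> \<subseteq> Field (Hausdorff_number X)"
    unfolding card_of_ordLeq[symmetric] by auto
  define B where "B = f ` Field \<kappa>"
  have "|Field \<kappa>| =o |B|"
    using inj_on_imp_bij_betw[OF f(1)] unfolding B_def card_of_ordIso[symmetric] by auto
  moreover have "|Field \<kappa>| =o \<kappa>"
    using assms(1) by (rule card_of_Field_ordIso)
  ultimately have eq: "\<kappa> =o |B|"
    by (meson ordIso_symmetric ordIso_transitive)
  then have "separates_from ( |B| ) X"
    using assms(2) separates_from_mono ordIso_imp_ordLeq by blast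
  then have "Hausdorff_number X \<le>o |B|"
    by (intro Hausdorff_number_least_aux card_of_Card_order)
  then have "Hausdorff_number X \<le>o \<kappa>"
    using eq ordIso_symmetric ordLeq_ordIso_trans by blast
  with \<open>\<not> Hausdorff_number X \<le>o \<kappa>\<close> show False by contradiction
qed

lemma n_Hausdorff_iff: "n_Hausdorff n X \<longleftrightarrow> separates_from ( |{..<n}| ) X"
  unfolding n_Hausdorff_def
  by (rule iffI, erule separates_from_mono[OF separates_from_Hausdorff_number],
      erule Hausdorff_number_least[OF card_of_Card_order])

text \<open>A space with fewer than \<open>n\<close> points is vacuously \<open>n\<close>-Hausdorff, and an indiscrete space is
  \<open>m\<close>-homogeneous for every \<open>m\<close>. So indiscrete spaces with at least two but fewer than \<open>n\<close>
  points are \<open>n\<close>-Hausdorff, \<open>m\<close>-homogeneous and not Hausdorff; the two-point one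
  is recorded here. Nonexistence results therefore need a lower bound on the
  number of points.\<close>

lemma small_indiscrete_example:
  assumes "n > 2"
  shows "\<exists>X :: bool topology. n_Hausdorff n X \<and> \<not> Hausdorff_space X \<and> (\<forall>m. m_homogeneous m X)"
proof -
  define X :: "bool topology" where "X = topology (\<lambda>U. U = {} \<or> U = UNIV)"
  have "istopology (\<lambda>U::bool set. U = {} \<or> U = UNIV)"
    unfolding istopology_def by blast
  then have op: "openin X U \<longleftrightarrow> U = {} \<or> U = UNIV" for U
    unfolding X_def by (simp add: topology_inverse')
  then have top: "topspace X = UNIV"
    unfolding topspace_def by auto
  have "\<not> |{..<n}| \<le>o |A|" for A :: "bool set"
  proof
    assume "|{..<n}| \<le>o |A|"
    then obtain f where "inj_on f {..<n}" "f ` {..<n} \<subseteq> A"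
      unfolding card_of_ordLeq[symmetric] by auto
    then have "n \<le> card A"
      using card_inj_on_le[of f "{..<n}" A] by simp
    also have "\<dots> \<le> 2"
      using card_mono[of "UNIV :: bool set" A] by simp
    finally show False using assms by simp
  qed
  then have "n_Hausdorff n X"
    unfolding n_Hausdorff_iff separates_from_def by blast
  moreover have "\<not> Hausdorff_space X"
    unfolding Hausdorff_space_def top op disjnt_def by blast
  moreover have "m_homogeneous m X" for m
    unfolding m_homogeneous_def
  proof (intro allI impI)
    fix x y :: "nat \<Rightarrow> bool"
    assume *: "(\<forall>i\<in>{1..m}. x i \<in> topspace X \<and> y i \<in> topspace X) \<and>
      (\<forall>i\<in>{1..m}. \<forall>j\<in>{1..m}. x i = x j \<longleftrightarrow> y i = y j)"
    have hom: "homeomorphic_map X X h" if "bij h" for h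
    proof -
      have inj: "inj h" and surj: "range h = UNIV"
        using that by (auto simp: bij_def)
      have "continuous_map X X h"
        unfolding continuous_map_def top op by auto
      moreover have "open_map X X h"
        unfolding open_map_def op using surj by auto
      ultimately show ?thesis
        using inj surj bijective_open_imp_homeomorphic_map[of X X h] unfolding top by blast
    qed
    show "\<exists>h. homeomorphic_map X X h \<and> (\<forall>i\<in>{1..m}. h (x i) = y i)"
    proof (cases "\<forall>i\<in>{1..m}. x i = y i")
      case True
      then show ?thesis by (intro exI[of _ id]) (simp add: hom)
    next
      case False
      then have "\<forall>i\<in>{1..m}. (\<not> x i) = y i" using * by blast
      moreover have "bij Not" by (rule o_bij[of Not]) auto
      ultimately show ?thesis using hom[of Not] by blast
    qed
  qed
  ultimately show ?thesis by blast
qed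

end

theory Submission
  imports Defs
begin

text \<open>If some two nonempty open sets are disjoint, some pair of distinct points is separated, and a
  homeomorphism moving pairs carries this separation to every other pair, so the space is Hausdorff.
  Otherwise nonempty open sets meet pairwise, hence so do any finitely many of them, and no set of
  \<open>n\<close> points can be separated.\<close>

text \<open>Reduces \<open>m\<close>-homogeneity to its two-point case: each pair is padded to an
  \<open>m\<close>-tuple by repeating its second point. Since both pairs consist of distinct points,
  the padded tuples have the same equality pattern.\<close>

lemma m_homogeneous_pair:
  assumes "m_homogeneous m X" "m > 1"
    and "a \<in> topspace X" "b \<in> topspace X" "a \<noteq> b"
    and "c \<in> topspace X" "d \<in> topspace X" "c \<noteq> d"
  obtains h where "homeomorphic_map X X h" "h a = c" "h b = d"
proof -
  define x where "x i = (if i = 1 then a else b)" for i :: nat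
  define y where "y i = (if i = 1 then c else d)" for i :: nat
  have "(\<forall>i\<in>{1..m}. x i \<in> topspace X \<and> y i \<in> topspace X) \<and>
        (\<forall>i\<in>{1..m}. \<forall>j\<in>{1..m}. x i = x j \<longleftrightarrow> y i = y j)"
    using assms(3-8) by (auto simp: x_def y_def)
  then obtain h where h: "homeomorphic_map X X h" "\<forall>i\<in>{1..m}. h (x i) = y i"
    using assms(1) unfolding m_homogeneous_def by blast
  \<comment> \<open>\<open>m > 1\<close> puts the index 2 in range, so the second point is really
    hit.\<close>
  have "h (x 1) = y 1" "h (x 2) = y 2"
    using h(2) assms(2) by auto
  then show thesis
    using that[of h] h(1) by (simp add: x_def y_def)
qed

lemma m_homogeneous_Hausdorff_if_disjoint_open:
  assumes "m_homogeneous m X" "m > 1"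
    and "openin X U" "openin X V" "U \<noteq> {}" "V \<noteq> {}" "U \<inter> V = {}"
  shows "Hausdorff_space X"
  unfolding Hausdorff_space_def
proof (intro allI impI, elim conjE)
  fix a b
  assume ab: "a \<in> topspace X" "b \<in> topspace X" "a \<noteq> b"
  obtain c d where cd: "c \<in> U" "d \<in> V"
    using assms(5,6) by blast
  then have "c \<in> topspace X" "d \<in> topspace X" "c \<noteq> d"
    using openin_subset[OF assms(3)] openin_subset[OF assms(4)] assms(7) by auto
  \<comment> \<open>The arbitrary pair is sent to the separated one, so that \<open>U\<close> and
    \<open>V\<close> can be pulled back along \<open>h\<close> by continuity alone.\<close>
  then obtain h where h: "homeomorphic_map X X h" "h a = c" "h b = d"
    by (rule m_homogeneous_pair[OF assms(1,2) ab])
  have "continuous_map X X h"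
    using h(1) by (rule homeomorphic_imp_continuous_map)
  then have "openin X {x \<in> topspace X. h x \<in> U}" "openin X {x \<in> topspace X. h x \<in> V}"
    using assms(3,4) by (auto intro: openin_continuous_map_preimage)
  moreover have "a \<in> {x \<in> topspace X. h x \<in> U}" "b \<in> {x \<in> topspace X. h x \<in> V}"
    using ab cd h by auto
  moreover have "disjnt {x \<in> topspace X. h x \<in> U} {x \<in> topspace X. h x \<in> V}"
    using assms(7) by (auto simp: disjnt_def)
  ultimately show "\<exists>U V. openin X U \<and> openin X V \<and> a \<in> U \<and> b \<in> V \<and> disjnt U V"
    by blast
qed

text \<open>Openness is part of the conclusion because the induction step applies
  \<open>meet\<close> to the intersection built so far. The factor \<open>topspace X\<close> turns
  the empty intersection into the whole space, which is the base case.\<close>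

lemma finite_Inter_open_nonempty:
  assumes meet: "\<And>U V. openin X U \<Longrightarrow> openin X V \<Longrightarrow> U \<noteq> {} \<Longrightarrow> V \<noteq> {} \<Longrightarrow> U \<inter> V \<noteq> {}"
    and "finite A" "topspace X \<noteq> {}" "\<And>a. a \<in> A \<Longrightarrow> openin X (U a) \<and> U a \<noteq> {}"
  shows "openin X (topspace X \<inter> (\<Inter>a\<in>A. U a)) \<and> topspace X \<inter> (\<Inter>a\<in>A. U a) \<noteq> {}"
  using assms(2,4)
proof (induction A rule: finite_induct)
  case empty
  then show ?case using assms(3) by simp
next
  case (insert a A)
  have eq: "topspace X \<inter> (\<Inter>a\<in>insert a A. U a) = U a \<inter> (topspace X \<inter> (\<Inter>a\<in>A. U a))"
    by auto
  show ?case
    unfolding eq using insert.IH[OF insert.prems[OF insertI2]] insert.prems[OF insertI1]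
    by (blast intro: openin_Int dest: meet)
qed

text \<open>The lower bound on the number of points excludes spaces that are
  \<open>n\<close>-Hausdorff only vacuously, such as the one in
  \<open>small_indiscrete_example\<close>.\<close>

theorem theorem2p5:
  fixes n m :: nat
  assumes "n > 2" and "m > 1"
  shows "\<not> (\<exists>X :: 'a topology. |{..<n}| \<le>o |topspace X| \<and>
              n_Hausdorff n X \<and> \<not> Hausdorff_space X \<and> m_homogeneous m X)"
proof
  assume "\<exists>X :: 'a topology. |{..<n}| \<le>o |topspace X| \<and>
              n_Hausdorff n X \<and> \<not> Hausdorff_space X \<and> m_homogeneous m X"
  then obtain X :: "'a topology" where card: "|{..<n}| \<le>o |topspace X|"
    and nH: "n_Hausdorff n X" and not_H: "\<not> Hausdorff_space X" and hom: "m_homogeneous m X"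
    by blast
  \<comment> \<open>The image of \<open>f\<close> is a finite set of exactly \<open>n\<close>
    points, to which the \<open>n\<close>-Hausdorff property is applied.\<close>
  obtain f where f: "inj_on f {..<n}" "f ` {..<n} \<subseteq> topspace X"
    using card unfolding card_of_ordLeq[symmetric] by auto
  have "|{..<n}| \<le>o |f ` {..<n}|"
    using f(1) unfolding card_of_ordLeq[symmetric] by blast
  with f(2) have "\<exists>U. (\<forall>a\<in>f ` {..<n}. openin X (U a) \<and> a \<in> U a) \<and>
      topspace X \<inter> (\<Inter>a\<in>f ` {..<n}. U a) = {}"
    using nH[unfolded n_Hausdorff_iff separates_from_def, rule_format, of "f ` {..<n}"] by simp
  then obtain U where U: "\<forall>a\<in>f ` {..<n}. openin X (U a) \<and> a \<in> U a"
    and empty: "topspace X \<inter> (\<Inter>a\<in>f ` {..<n}. U a) = {}"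
    by (elim exE conjE)
  have meet: "U \<inter> V \<noteq> {}" if "openin X U" "openin X V" "U \<noteq> {}" "V \<noteq> {}" for U V
    using m_homogeneous_Hausdorff_if_disjoint_open[OF hom assms(2) that] not_H by blast
  have "f 0 \<in> topspace X"
    using f(2) assms(1) by auto
  then have "topspace X \<noteq> {}"
    by auto
  moreover have "openin X (U a) \<and> U a \<noteq> {}" if "a \<in> f ` {..<n}" for a
    using U that by auto
  ultimately have "topspace X \<inter> (\<Inter>a\<in>f ` {..<n}. U a) \<noteq> {}"
    using finite_Inter_open_nonempty[OF meet, where A = "f ` {..<n}" and U = U] by blast
  with empty show False by contradiction
qed

end
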